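(* Let $h:J\subseteq\mathbb{R}\to\mathbb{R}$ be a nonnegative super-multiplicative function with $h(\alpha)\ge\alpha$ for all $\alpha\in(0,1)$. Let $f:I\subseteq\mathbb{R}\to\mathbb{R}$ be a differentiable mapping on $I^{\circ}$ such that $f'\in L[a,b]$, where $a,b\in I$ with $a<b$. If $|f'|$ is an $h$-convex function on $I$ and $|f'(x)|\le M$ for all $x\in[a,b]$, then for each $x\in[a,b]$ $$\left|f(x)-\frac{1}{b-a}\int_a^b f(u)\,du\right|\le \frac{M\left[(x-a)^2+(b-x)^2\right]}{b-a}\int_0^1\left[h(t^2)+h(t-t^2)\right]dt.$$
   Context: $I\subseteq\mathbb{R}$ is an interval, $I^{\circ}$ is its interior, and $L[a,b]$ is the space of Lebesgue integrable functions on $[a,b]$. $J\subseteq\mathbb{R}$ is an interval with $[0,1]\subseteq J$, and $h\not\equiv 0$. $h:J\to\mathbb{R}$ is super-multiplicative if $h(xy)\ge h(x)h(y)$ for all $x,y\in J$ with $xy\in J$. A function $g:I\to\mathbb{R}$ is $h$-convex (for a nonnegative $h:J\to\mathbb{R}$, $h\not\equiv0$) if $g$ is nonnegative and $g(tx+(1-t)y)\le h(t)g(x)+h(1-t)g(y)$ for all $x,y\in I$ and $t\in[0,1]$. $h$-convexity on a subinterval is defined the same way. Hypotheses on the values of $f'$ at points of $I$ or $[a,b]$ presuppose that $f$ is differentiable there (one-sidedly at an endpoint of $I$). The integral of $h$ on the right-hand side is presupposed to make sense (value $+\infty$ allowed). *)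

theory Defs
  imports "HOL-Analysis.Analysis"
begin

text \<open>
  Functions on an interval are represented by total functions on the reals together with their
  domain; only values on the domain are constrained.
\<close>

definition super_multiplicative_on :: "real set \<Rightarrow> (real \<Rightarrow> real) \<Rightarrow> bool" where
  "super_multiplicative_on J h \<longleftrightarrow>
     (\<forall>x\<in>J. \<forall>y\<in>J. x * y \<in> J \<longrightarrow> h (x * y) \<ge> h x * h y)"

text \<open>
  Only the values of \<open>h\<close> on \<open>[0,1]\<close> enter; that \<open>h\<close> is nonnegative and not identically zero on its
  own domain is to be assumed separately.
\<close>

definition h_convex_on :: "(real \<Rightarrow> real) \<Rightarrow> real set \<Rightarrow> (real \<Rightarrow> real) \<Rightarrow> bool" where
  "h_convex_on h I g \<longleftrightarrow>
     (\<forall>x\<in>I. 0 \<le> g x) \<and>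
     (\<forall>x\<in>I. \<forall>y\<in>I. \<forall>t\<in>{0..1}. g (t * x + (1 - t) * y) \<le> h t * g x + h (1 - t) * g y)"

end

theory Submission imports Defs
begin

text \<open>
  The derivative bound alone gives Ostrowski's inequality with constant \<open>1/2\<close>, because
  \<open>\<bar>f x - f u\<bar> \<le> M \<bar>x - u\<bar>\<close>. The growth condition on \<open>h\<close> gives \<open>h (t\<^sup>2) + h (t - t\<^sup>2) \<ge> t\<close> on
  \<open>(0,1)\<close>, so the integral on the right-hand side is at least \<open>1/2\<close>.
\<close>

text \<open>The interval is split at \<open>x\<close>, where \<open>x - u\<close> changes sign. On
  each half the integrand is linear, with antiderivative \<open>- (x - u)\<^sup>2 / 2\<close> on the
  left and \<open>(u - x)\<^sup>2 / 2\<close> on the right.\<close>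

lemma has_integral_abs_diff:
  fixes a b x :: real
  assumes "x \<in> {a..b}"
  shows "((\<lambda>u. \<bar>x - u\<bar>) has_integral ((x - a)\<^sup>2 + (b - x)\<^sup>2) / 2) {a..b}"
proof -
  have "((\<lambda>u. x - u) has_integral (- ((x - x)\<^sup>2 / 2) - - ((x - a)\<^sup>2 / 2))) {a..x}"
    using assms
    by (intro fundamental_theorem_of_calculus)
       (auto intro!: derivative_eq_intros simp: has_real_derivative_iff_has_vector_derivative[symmetric] field_simps)
  then have "((\<lambda>u. \<bar>x - u\<bar>) has_integral (x - a)\<^sup>2 / 2) {a..x}"
    by (auto intro: has_integral_eq[rotated])
  moreover have "((\<lambda>u. u - x) has_integral ((b - x)\<^sup>2 / 2 - (x - x)\<^sup>2 / 2)) {x..b}"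
    using assms
    by (intro fundamental_theorem_of_calculus)
       (auto intro!: derivative_eq_intros simp: has_real_derivative_iff_has_vector_derivative[symmetric] field_simps)
  then have "((\<lambda>u. \<bar>x - u\<bar>) has_integral (b - x)\<^sup>2 / 2) {x..b}"
    by (auto intro: has_integral_eq[rotated])
  ultimately show ?thesis
    using assms has_integral_combine[of a x b "\<lambda>u. \<bar>x - u\<bar>"] by (simp add: add_divide_distrib)
qed

text \<open>Since \<open>f x\<close> is constant in \<open>u\<close>, the left-hand side is the
  absolute mean of \<open>f x - f u\<close> over the interval, so a pointwise bound on
  \<open>f x - f u\<close> can be integrated. The factor \<open>1 / 2\<close> is kept apart so that
  the integral of the \<open>h\<close> terms can replace it later.\<close>

lemma Ostrowski_inequality:
  fixes f f' :: "real \<Rightarrow> real"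
  assumes "a < b"
    and deriv: "\<And>u. u \<in> {a..b} \<Longrightarrow> (f has_real_derivative f' u) (at u within {a..b})"
    and bound: "\<And>u. u \<in> {a..b} \<Longrightarrow> \<bar>f' u\<bar> \<le> M"
    and x: "x \<in> {a..b}"
  shows "\<bar>f x - 1 / (b - a) * integral {a..b} f\<bar>
    \<le> M * ((x - a)\<^sup>2 + (b - x)\<^sup>2) / (b - a) * (1 / 2)"
proof -
  have int: "f integrable_on {a..b}"
    by (intro integrable_continuous_real DERIV_continuous_on[OF deriv])
  have "((\<lambda>u. f x - f u) has_integral ((b - a) * f x - integral {a..b} f)) {a..b}"
    using has_integral_diff[OF has_integral_const_real integrable_integral[OF int], of "f x"] \<open>a < b\<close>
    by simp
  moreover have "((\<lambda>u. M * \<bar>x - u\<bar>) has_integral M * (((x - a)\<^sup>2 + (b - x)\<^sup>2) / 2)) {a..b}"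
    by (intro has_integral_mult_right has_integral_abs_diff x)
  \<comment> \<open>Mean value inequality on the convex set \<open>{a..b}\<close>.\<close>
  moreover have "\<bar>f x - f u\<bar> \<le> M * \<bar>x - u\<bar>" if "u \<in> {a..b}" for u
    using field_differentiable_bound[of "{a..b}" f f' M x u] deriv bound x that
    by simp
  ultimately have le: "\<bar>(b - a) * f x - integral {a..b} f\<bar> \<le> M * (((x - a)\<^sup>2 + (b - x)\<^sup>2) / 2)"
    using integral_norm_bound_integral[of "\<lambda>u. f x - f u" "{a..b}" "\<lambda>u. M * \<bar>x - u\<bar>"]
    by (metis has_integral_integrable integral_unique real_norm_def)
  have "f x - 1 / (b - a) * integral {a..b} f
      = ((b - a) * f x - integral {a..b} f) / (b - a)"
    using \<open>a < b\<close> by (simp add: field_simps)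
  then show ?thesis
    using divide_right_mono[OF le, of "b - a"] \<open>a < b\<close> by (simp add: mult.commute)
qed

text \<open>The number \<open>1 / 2\<close> is the integral of the identity over the unit interval,
  and the integral is monotone. Working in \<open>ennreal\<close> admits an infinite integral of
  \<open>g\<close>.\<close>

lemma half_le_nn_integral:
  fixes g :: "real \<Rightarrow> real"
  assumes "\<And>t. t \<in> {0<..<1} \<Longrightarrow> t \<le> g t"
  shows "ennreal (1 / 2) \<le> (\<integral>\<^sup>+ t. ennreal (g t) \<partial>lebesgue_on {0..1})"
proof -
  have id: "((\<lambda>t. t) has_integral 1 / 2) {0..1::real}"
    using ident_has_integral[of 0 "1::real"] by simp
  have "ennreal (1 / 2) = (\<integral>\<^sup>+ t. ennreal t \<partial>lebesgue_on {0..1})"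
    using nn_integral_has_integral_lebesgue'[OF _ id]
    by (simp add: nn_integral_restrict_space nn_integral_completion)
  also have "\<dots> \<le> (\<integral>\<^sup>+ t. ennreal (g t) \<partial>lebesgue_on {0..1})"
  proof (rule nn_integral_mono_AE)
    \<comment> \<open>Nothing is assumed about \<open>g 1\<close>, so the point 1 is discarded as a
      null set.\<close>
    have "AE t in lebesgue. t \<noteq> (1::real)"
      by (intro AE_completion AE_lborel_singleton)
    then have "AE t in lebesgue_on {0..1}. t \<noteq> (1::real)"
      by (auto simp: AE_restrict_space_iff elim: eventually_mono)
    then show "AE t in lebesgue_on {0..1}. ennreal t \<le> ennreal (g t)"
    proof (rule AE_mp, intro AE_I2 impI)
      fix t :: real
      assume "t \<in> space (lebesgue_on {0..1})" "t \<noteq> 1"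
      \<comment> \<open>At \<open>t = 0\<close> the left-hand side is \<open>ennreal 0\<close>, the
        least element, whatever \<open>g 0\<close> is.\<close>
      then consider "t = 0" | "t \<in> {0<..<1}" by fastforce
      then show "ennreal t \<le> ennreal (g t)"
        by cases (use assms in \<open>auto intro: ennreal_leI\<close>)
    qed
  qed
  finally show ?thesis .
qed

theorem theorem2:
  fixes I J :: "real set" and f f' h :: "real \<Rightarrow> real" and a b M :: real
  assumes "is_interval J" and "{0..1} \<subseteq> J"
    and "\<forall>t\<in>J. 0 \<le> h t" and "\<exists>t\<in>J. h t \<noteq> 0"
    and "super_multiplicative_on J h"
    and "\<forall>\<alpha>\<in>{0<..<1}. h \<alpha> \<ge> \<alpha>"
    and "(\<lambda>t. h (t\<^sup>2) + h (t - t\<^sup>2)) \<in> borel_measurable (lebesgue_on {0..1})"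
    and "is_interval I" and "a \<in> I" and "b \<in> I" and "a < b"
    and "\<forall>x\<in>interior I. (f has_real_derivative f' x) (at x)"
    and "\<forall>x\<in>I - interior I. (f has_real_derivative f' x) (at x within I)"
    and "f' absolutely_integrable_on {a..b}"
    and "h_convex_on h I (\<lambda>x. \<bar>f' x\<bar>)"
    and "\<forall>x\<in>{a..b}. \<bar>f' x\<bar> \<le> M"
  shows "\<forall>x\<in>{a..b}.
    ennreal \<bar>f x - 1 / (b - a) * integral {a..b} f\<bar>
      \<le> ennreal (M * ((x - a)\<^sup>2 + (b - x)\<^sup>2) / (b - a))
         * (\<integral>\<^sup>+ t. ennreal (h (t\<^sup>2) + h (t - t\<^sup>2)) \<partial>lebesgue_on {0..1})"
proof
  fix x
  assume x: "x \<in> {a..b}"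
  have sub: "{a..b} \<subseteq> I"
    using assms(8-10) mem_is_interval_1_I[of I a b] by auto
  \<comment> \<open>Two-sided derivatives in the interior of \<open>I\<close> and one-sided ones at
    its endpoints both restrict to derivatives within \<open>{a..b}\<close>.\<close>
  have deriv: "(f has_real_derivative f' u) (at u within {a..b})" if "u \<in> {a..b}" for u
  proof (cases "u \<in> interior I")
    case True
    then show ?thesis
      using assms(12) has_field_derivative_at_within by blast
  next
    case False
    then show ?thesis
      using assms(13) that sub DERIV_subset[OF _ sub] by blast
  qed
  \<comment> \<open>Both arguments lie in the open unit interval and sum to \<open>t\<close>, so the
    growth condition is applied to each and the two bounds are added.\<close>
  have "t \<le> h (t\<^sup>2) + h (t - t\<^sup>2)" if "t \<in> {0<..<1}" for t
  proof -
    have "0 < t\<^sup>2" "t\<^sup>2 < t"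
      using that mult_strict_left_mono[of t 1 t] by (auto simp: power2_eq_square)
    then have "t\<^sup>2 \<in> {0<..<1}" "t - t\<^sup>2 \<in> {0<..<1}"
      using that by (simp_all, linarith+)
    then have "t\<^sup>2 \<le> h (t\<^sup>2)" "t - t\<^sup>2 \<le> h (t - t\<^sup>2)"
      using assms(6) by blast+
    then show ?thesis by simp
  qed
  then have half: "ennreal (1 / 2) \<le> (\<integral>\<^sup>+ t. ennreal (h (t\<^sup>2) + h (t - t\<^sup>2)) \<partial>lebesgue_on {0..1})"
    by (rule half_le_nn_integral)
  \<comment> \<open>The sign of \<open>M\<close> makes the prefactor nonnegative, so that
    \<open>ennreal\<close> of the product below splits into a product.\<close>
  have "0 \<le> M"
    using assms(16) x abs_ge_zero order_trans by blast
  then have nonneg: "0 \<le> M * ((x - a)\<^sup>2 + (b - x)\<^sup>2) / (b - a)"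
    using \<open>a < b\<close> by simp
  have "ennreal \<bar>f x - 1 / (b - a) * integral {a..b} f\<bar>
      \<le> ennreal (M * ((x - a)\<^sup>2 + (b - x)\<^sup>2) / (b - a) * (1 / 2))"
    using Ostrowski_inequality[OF \<open>a < b\<close> deriv _ x] assms(16) by (intro ennreal_leI) blast
  also have "\<dots> = ennreal (M * ((x - a)\<^sup>2 + (b - x)\<^sup>2) / (b - a)) * ennreal (1 / 2)"
    using nonneg by (intro ennreal_mult) auto
  also have "\<dots> \<le> ennreal (M * ((x - a)\<^sup>2 + (b - x)\<^sup>2) / (b - a))
      * (\<integral>\<^sup>+ t. ennreal (h (t\<^sup>2) + h (t - t\<^sup>2)) \<partial>lebesgue_on {0..1})"
    using half by (rule mult_left_mono) simp
  finally show "ennreal \<bar>f x - 1 / (b - a) * integral {a..b} f\<bar>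
      \<le> ennreal (M * ((x - a)\<^sup>2 + (b - x)\<^sup>2) / (b - a))
         * (\<integral>\<^sup>+ t. ennreal (h (t\<^sup>2) + h (t - t\<^sup>2)) \<partial>lebesgue_on {0..1})" .
qed

end
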